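(* Let $\Theta$ be a finite parameter space. The stable conditionality relation $SC$ is an equivalence relation on the set of all inference bases with parameter space $\Theta$.
   Context: Inference bases. Fix a finite parameter space $\Theta$. An inference base is a pair $(M,x)$ where $M=(\mathcal{X},\{P_{\theta,X}:\theta\in\Theta\})$ is a statistical model with finite sample space $\mathcal{X}$ (with $\sigma$-algebra the power set), each $P_{\theta,X}$ is a probability measure on $\mathcal{X}$, for each $z\in\mathcal{X}$ there is at least one $\theta\in\Theta$ with $P_{\theta,X}(\{z\})>0$, and $x\in\mathcal{X}$ is the observed data. All inference bases considered have the same $\Theta$. Minimal sufficient statistic. For $y,z\in\mathcal{X}$ write $y\equiv_S z$ if there is a constant $c$ with $P_{\theta,X}(\{y\})=cP_{\theta,X}(\{z\})$ for every $\theta\in\Theta$; this is an equivalence relation. A minimal sufficient statistic (mss) for $M$ is a surjective function $T:\mathcal{X}\to\mathcal{T}$ with $T(y)=T(z)$ if and only if $y\equiv_S z$. It is unique up to 1-1 relabelling. $M_T=(\mathcal{T},\{P_{\theta,T}:\theta\in\Theta\})$ is the model of the distributions of $T$. Ancillaries. An ancillary for a model is a function on its sample space whose distribution does not depend on $\theta$. It is a maximal ancillary if, whenever it equals $h(A')$ for an ancillary $A'$ and a function $h$, then $h$ is 1-1 on the range of $A'$. A minimal ancillary is an ancillary that is a function of every maximal ancillary. The laminal ancillary is the minimal ancillary of which every minimal ancillary is a function; it exists and is unique up to 1-1 relabelling. For the model $M$ with mss $T$, the laminal ancillary used is $L=g\circ T$, where $g$ is the laminal ancillary of the model $M_T$ (only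 ancillaries that are functions of the mss are considered). Conditional model. $M_{T\mid L(x)}$ is the model for $T$ with sample space $\{t\in\mathcal{T}:g(t)=g(T(x))\}$ and probability measures $P_{\theta,T\mid L(x)}=P_{\theta,T}(\cdot\mid g(t)=g(T(x)))$, $\theta\in\Theta$. For a bijection $h$ defined on $\mathcal{T}$, $M_{h(T)\mid L(x)}$ is the model obtained from it by relabelling (pushing forward the sample space and each probability measure) via $h$. The relation $SC$ (Stable Conditionality Principle). Let $(M_1,x_1)$ and $(M_2,x_2)$ be inference bases with minimal sufficient statistics $T_i:\mathcal{X}_i\to\mathcal{T}_i$ and laminal ancillaries $L_i=g_i\circ T_i$, where $g_i$ is the laminal ancillary of the model $M_{i,T_i}$ of the distributions of $T_i$, $i=1,2$. They are equivalent under $SC$ if there is a bijection $h:\mathcal{T}_2\to\mathcal{T}_1$ such that $$(M_{1,T_1\mid L_1(x_1)},T_1(x_1))=(M_{2,h(T_2)\mid L_2(x_2)},h(T_2(x_2))),$$ i.e. the sample spaces coincide, the probability measures coincide for each $\theta\in\Theta$, and $T_1(x_1)=h(T_2(x_2))$. *)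

theory Defs
  imports "HOL-Probability.Probability"
begin

record ('p, 'x) model =
  sample_space :: "'x set"
  distribution :: "'p \<Rightarrow> 'x measure"

type_synonym ('p, 'x) base = "('p, 'x) model \<times> 'x"

text \<open>
  The family of distributions is extensional on \<open>\<Theta>\<close>, so that equality of records is equality of
  models. The parameter space \<open>\<Theta>\<close> is assumed finite where it is used.
\<close>

definition stat_model :: "'p set \<Rightarrow> ('p, 'x) model \<Rightarrow> bool" where
  "stat_model \<Theta> M \<longleftrightarrow>
     finite (sample_space M) \<and>
     distribution M \<in> \<Theta> \<rightarrow>\<^sub>E {P. prob_space P \<and> space P = sample_space M \<and> sets P = Pow (sample_space M)} \<and>
     (\<forall>z\<in>sample_space M. \<exists>\<theta>\<in>\<Theta>. measure (distribution M \<theta>) {z} > 0)"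

definition inference_base :: "'p set \<Rightarrow> ('p, 'x) base \<Rightarrow> bool" where
  "inference_base \<Theta> = (\<lambda>(M, x). stat_model \<Theta> M \<and> x \<in> sample_space M)"

text \<open>
  The model of the distributions of \<open>T\<close>, whose sample space is the range of \<open>T\<close>. For a function that
  is injective on the sample space this is the relabelled model. On a finite set, \<open>count_space\<close>
  supplies the power set as \<open>\<sigma>\<close>-algebra.
\<close>

definition image_model :: "'p set \<Rightarrow> ('x \<Rightarrow> 't) \<Rightarrow> ('p, 'x) model \<Rightarrow> ('p, 't) model" where
  "image_model \<Theta> T M =
     \<lparr>sample_space = T ` sample_space M,
      distribution = (\<lambda>\<theta>\<in>\<Theta>. distr (distribution M \<theta>) (count_space (T ` sample_space M)) T)\<rparr>"

text \<open>
  The conditional model given \<open>C\<close>: \<open>uniform_measure P C\<close> is \<open>B \<mapsto> P (C \<inter> B) / P C\<close>, and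
  \<open>restrict_space\<close> cuts the sample space down to \<open>C\<close>.
\<close>

definition cond_model :: "'p set \<Rightarrow> 'x set \<Rightarrow> ('p, 'x) model \<Rightarrow> ('p, 'x) model" where
  "cond_model \<Theta> C M =
     \<lparr>sample_space = C,
      distribution = (\<lambda>\<theta>\<in>\<Theta>. restrict_space (uniform_measure (distribution M \<theta>) C) C)\<rparr>"

definition suff_equiv :: "'p set \<Rightarrow> ('p, 'x) model \<Rightarrow> 'x \<Rightarrow> 'x \<Rightarrow> bool" where
  "suff_equiv \<Theta> M y z \<longleftrightarrow>
     (\<exists>c::real. \<forall>\<theta>\<in>\<Theta>. measure (distribution M \<theta>) {y} = c * measure (distribution M \<theta>) {z})"

definition min_sufficient :: "'p set \<Rightarrow> ('p, 'x) model \<Rightarrow> ('x \<Rightarrow> 't) \<Rightarrow> bool" where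
  "min_sufficient \<Theta> M T \<longleftrightarrow>
     (\<forall>y\<in>sample_space M. \<forall>z\<in>sample_space M. T y = T z \<longleftrightarrow> suff_equiv \<Theta> M y z)"

definition ancillary :: "'p set \<Rightarrow> ('p, 'x) model \<Rightarrow> ('x \<Rightarrow> 'a) \<Rightarrow> bool" where
  "ancillary \<Theta> M A \<longleftrightarrow>
     (\<forall>\<theta>\<in>\<Theta>. \<forall>\<theta>'\<in>\<Theta>.
        distr (distribution M \<theta>) (count_space (A ` sample_space M)) A =
        distr (distribution M \<theta>') (count_space (A ` sample_space M)) A)"

text \<open>
  A statistic is known only up to 1-1 relabelling and has finite range, so wherever a definition
  quantifies over statistics it is enough to let them take values in \<^typ>\<open>nat\<close>. (A type variable
  instead could be instantiated with a type too small to hold the labels.)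
\<close>

definition maximal_ancillary :: "'p set \<Rightarrow> ('p, 'x) model \<Rightarrow> ('x \<Rightarrow> 'a) \<Rightarrow> bool" where
  "maximal_ancillary \<Theta> M A \<longleftrightarrow>
     ancillary \<Theta> M A \<and>
     (\<forall>(A' :: 'x \<Rightarrow> nat) h. ancillary \<Theta> M A' \<longrightarrow> (\<forall>z\<in>sample_space M. A z = h (A' z)) \<longrightarrow>
        inj_on h (A' ` sample_space M))"

definition minimal_ancillary :: "'p set \<Rightarrow> ('p, 'x) model \<Rightarrow> ('x \<Rightarrow> 'a) \<Rightarrow> bool" where
  "minimal_ancillary \<Theta> M A \<longleftrightarrow>
     ancillary \<Theta> M A \<and>
     (\<forall>A' :: 'x \<Rightarrow> nat. maximal_ancillary \<Theta> M A' \<longrightarrow> (\<exists>h. \<forall>z\<in>sample_space M. A z = h (A' z)))"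

definition laminal_ancillary :: "'p set \<Rightarrow> ('p, 'x) model \<Rightarrow> ('x \<Rightarrow> 'a) \<Rightarrow> bool" where
  "laminal_ancillary \<Theta> M A \<longleftrightarrow>
     minimal_ancillary \<Theta> M A \<and>
     (\<forall>A' :: 'x \<Rightarrow> nat. minimal_ancillary \<Theta> M A' \<longrightarrow> (\<exists>h. \<forall>z\<in>sample_space M. A' z = h (A z)))"

text \<open>
  The base \<open>(M\<^bsub>T|L(x)\<^esub>, T x)\<close>, where \<open>L = g \<circ> T\<close>.
\<close>

definition cond_base ::
    "'p set \<Rightarrow> ('x \<Rightarrow> 't) \<Rightarrow> ('t \<Rightarrow> 'a) \<Rightarrow> ('p, 'x) base \<Rightarrow> ('p, 't) base" where
  "cond_base \<Theta> T g = (\<lambda>(M, x).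
     (cond_model \<Theta> {t \<in> T ` sample_space M. g t = g (T x)} (image_model \<Theta> T M), T x))"

definition relabel_base :: "'p set \<Rightarrow> ('t \<Rightarrow> 'u) \<Rightarrow> ('p, 't) base \<Rightarrow> ('p, 'u) base" where
  "relabel_base \<Theta> h = (\<lambda>(M, t). (image_model \<Theta> h M, h t))"

text \<open>
  As the minimal sufficient statistics and the laminal ancillaries are determined up to 1-1
  relabelling, they are existentially quantified. Note that \<open>h\<close> is a bijection between the full
  ranges of the minimal sufficient statistics, not only between the conditional sample spaces.
\<close>

definition stable_cond :: "'p set \<Rightarrow> ('p, 'x) base rel" where
  "stable_cond \<Theta> = {(B\<^sub>1, B\<^sub>2).
     inference_base \<Theta> B\<^sub>1 \<and> inference_base \<Theta> B\<^sub>2 \<and>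
     (\<exists>(T\<^sub>1 :: 'x \<Rightarrow> nat) (T\<^sub>2 :: 'x \<Rightarrow> nat) (g\<^sub>1 :: nat \<Rightarrow> nat) (g\<^sub>2 :: nat \<Rightarrow> nat) h.
        min_sufficient \<Theta> (fst B\<^sub>1) T\<^sub>1 \<and> laminal_ancillary \<Theta> (image_model \<Theta> T\<^sub>1 (fst B\<^sub>1)) g\<^sub>1 \<and>
        min_sufficient \<Theta> (fst B\<^sub>2) T\<^sub>2 \<and> laminal_ancillary \<Theta> (image_model \<Theta> T\<^sub>2 (fst B\<^sub>2)) g\<^sub>2 \<and>
        bij_betw h (T\<^sub>2 ` sample_space (fst B\<^sub>2)) (T\<^sub>1 ` sample_space (fst B\<^sub>1)) \<and>
        cond_base \<Theta> T\<^sub>1 g\<^sub>1 B\<^sub>1 = relabel_base \<Theta> h (cond_base \<Theta> T\<^sub>2 g\<^sub>2 B\<^sub>2))}"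

end

theory Submission
  imports Defs
begin

text \<open>
  Once minimal sufficient statistics and laminal ancillaries are known to exist, reflexivity takes
  the identity relabelling and symmetry the inverse one. Transitivity is where uniqueness matters:
  the two hypotheses on \<open>(B\<^sub>1, B\<^sub>2)\<close> and \<open>(B\<^sub>2, B\<^sub>3)\<close> may describe the middle base by different pairs
  \<open>(T, g)\<close> and \<open>(T', g')\<close>. The lemma \<open>cond_base_unique\<close> supplies a bijection \<open>k\<close> between the ranges
  of \<open>T'\<close> and \<open>T\<close> that carries one conditional base to the other, so the bijection from the range of
  \<open>T\<^sub>3\<close> to that of \<open>T\<^sub>1\<close> is the composition of the two given ones with \<open>k\<close> in between.

  Uniqueness holds because \<open>T\<close> and \<open>T'\<close> have the same level sets, so \<open>T = k \<circ> T'\<close>. Every notion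
  of ancillarity is invariant under the relabelling \<open>k\<close>, so \<open>g \<circ> k\<close> and \<open>g'\<close> are both laminal for
  the model of \<open>T'\<close> and have the same level sets. The conditioning events therefore correspond under
  \<open>k\<close>, and conditioning commutes with relabelling (\<open>cond_model_image_model\<close>).

  For existence, a minimal sufficient statistic labels the classes of \<open>\<equiv>\<^sub>S\<close>, and a laminal ancillary
  labels the classes of the relation ``no minimal ancillary separates \<open>y\<close> from \<open>z\<close>''. The latter
  statistic is a function of each maximal ancillary. On a finite sample space a maximal ancillary
  exists, and a function of an ancillary is ancillary, so the statistic is itself a minimal
  ancillary (\<open>ex_laminal_ancillary\<close>).
\<close>

section \<open>Relabelling models\<close>

text \<open>
  The properties that relabelling and conditioning preserve and that equations between models rest
  on: the power set as \<open>\<sigma>\<close>-algebra makes every statistic measurable, and extensionality reduces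
  equality of families to equality at each \<open>\<theta> \<in> \<Theta>\<close>.
\<close>

definition discrete_model :: "'p set \<Rightarrow> ('p, 'x) model \<Rightarrow> bool" where
  "discrete_model \<Theta> M \<longleftrightarrow>
     distribution M \<in> \<Theta> \<rightarrow>\<^sub>E {P. sets P = Pow (sample_space M)}"

lemma discrete_modelD:
  assumes "discrete_model \<Theta> M" "\<theta> \<in> \<Theta>"
  shows "sets (distribution M \<theta>) = Pow (sample_space M)"
    and "space (distribution M \<theta>) = sample_space M"
proof -
  show *: "sets (distribution M \<theta>) = Pow (sample_space M)"
    using assms by (auto simp: discrete_model_def PiE_iff)
  show "space (distribution M \<theta>) = sample_space M"
    using sets_eq_imp_space_eq[of "distribution M \<theta>" "count_space (sample_space M)"] * by simp
qed

lemma discrete_model_measurable: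
  assumes "discrete_model \<Theta> M" "\<theta> \<in> \<Theta>" "f ` sample_space M \<subseteq> A"
  shows "f \<in> measurable (distribution M \<theta>) (count_space A)"
  using assms by (auto simp: measurable_def discrete_modelD)

lemma discrete_model_extensional:
  "discrete_model \<Theta> M \<Longrightarrow> distribution M \<in> extensional \<Theta>"
  by (auto simp: discrete_model_def PiE_iff)

lemma stat_model_discrete: "stat_model \<Theta> M \<Longrightarrow> discrete_model \<Theta> M"
  by (auto simp: stat_model_def discrete_model_def PiE_iff)

lemma sample_space_image_model [simp]:
  "sample_space (image_model \<Theta> f M) = f ` sample_space M"
  by (simp add: image_model_def)

lemma sample_space_cond_model [simp]: "sample_space (cond_model \<Theta> C M) = C"
  by (simp add: cond_model_def)

lemma discrete_image_model: "discrete_model \<Theta> (image_model \<Theta> f M)"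
  by (auto simp: discrete_model_def image_model_def)

lemma discrete_cond_model:
  assumes "discrete_model \<Theta> M" "C \<subseteq> sample_space M"
  shows "discrete_model \<Theta> (cond_model \<Theta> C M)"
proof -
  have "(\<inter>) C ` Pow (sample_space M) = Pow C"
    using assms(2) by (auto simp: image_iff)
  then show ?thesis
    using discrete_modelD[OF assms(1)]
    by (auto simp: discrete_model_def cond_model_def sets_restrict_space)
qed

lemma image_model_cong:
  assumes "discrete_model \<Theta> M" "\<And>z. z \<in> sample_space M \<Longrightarrow> f z = g z"
  shows "image_model \<Theta> f M = image_model \<Theta> g M"
proof -
  have "f ` sample_space M = g ` sample_space M"
    using assms(2) by (auto simp: image_iff)
  then show ?thesis
    using assms by (auto simp: image_model_def discrete_modelD intro!: restrict_ext distr_cong)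
qed

lemma image_model_comp:
  assumes "discrete_model \<Theta> M"
  shows "image_model \<Theta> g (image_model \<Theta> f M) = image_model \<Theta> (g \<circ> f) M"
  unfolding image_model_def
  by (auto simp: image_comp intro!: restrict_ext distr_distr discrete_model_measurable[OF assms])

lemma image_model_ident:
  assumes "discrete_model \<Theta> M" "\<And>z. z \<in> sample_space M \<Longrightarrow> f z = z"
  shows "image_model \<Theta> f M = M"
proof -
  have im: "f ` sample_space M = sample_space M"
    using assms(2) by (auto simp: image_iff)
  have "distr (distribution M \<theta>) (count_space (sample_space M)) f = distribution M \<theta>"
    if "\<theta> \<in> \<Theta>" for \<theta>
  proof -
    have "distr (distribution M \<theta>) (count_space (sample_space M)) f
        = distr (distribution M \<theta>) (distribution M \<theta>) (\<lambda>z. z)"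
      using assms that by (intro distr_cong) (auto simp: discrete_modelD)
    then show ?thesis
      by simp
  qed
  then have "(\<lambda>\<theta>\<in>\<Theta>. distr (distribution M \<theta>) (count_space (sample_space M)) f) = distribution M"
    using discrete_model_extensional[OF assms(1)]
    by (intro ext) (auto simp: restrict_def extensional_def)
  then show ?thesis
    by (simp add: image_model_def im)
qed

text \<open>
  As \<open>k\<close> is injective, the preimage of \<open>k ` C\<close> is \<open>C\<close> itself, so on both sides the probability of
  \<open>B \<subseteq> k ` C\<close> is the quotient of the probabilities of \<open>k -` B \<inter> C\<close> and of \<open>C\<close>.
\<close>

lemma cond_model_image_model:
  assumes M: "discrete_model \<Theta> M" and k: "inj_on k (sample_space M)"
    and C: "C \<subseteq> sample_space M"
  shows "cond_model \<Theta> (k ` C) (image_model \<Theta> k M) = image_model \<Theta> k (cond_model \<Theta> C M)"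
proof -
  have "restrict_space (uniform_measure (distribution (image_model \<Theta> k M) \<theta>) (k ` C)) (k ` C)
      = distr (distribution (cond_model \<Theta> C M) \<theta>) (count_space (k ` C)) k" (is "?l = ?r")
    if \<theta>: "\<theta> \<in> \<Theta>" for \<theta>
  proof (rule measure_eqI)
    let ?P = "distribution M \<theta>"
    let ?Q = "distr ?P (count_space (k ` sample_space M)) k"
    have Q: "distribution (image_model \<Theta> k M) \<theta> = ?Q"
      using \<theta> by (simp add: image_model_def)
    have R: "distribution (cond_model \<Theta> C M) \<theta> = restrict_space (uniform_measure ?P C) C"
      using \<theta> by (simp add: cond_model_def)
    have kC: "k ` C \<subseteq> k ` sample_space M"
      using C by auto
    have "discrete_model \<Theta> (cond_model \<Theta> (k ` C) (image_model \<Theta> k M))"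
      using kC by (intro discrete_cond_model discrete_image_model) simp
    from discrete_modelD(1)[OF this \<theta>] have sl: "sets ?l = Pow (k ` C)"
      using \<theta> by (simp add: cond_model_def)
    then show "sets ?l = sets ?r"
      by simp
    fix B assume "B \<in> sets ?l"
    with sl have B: "B \<subseteq> k ` C"
      by simp
    have meas: "k \<in> measurable ?P (count_space (k ` sample_space M))"
      by (rule discrete_model_measurable[OF M \<theta>]) simp
    have measC: "k \<in> measurable (restrict_space (uniform_measure ?P C) C) (count_space (k ` C))"
      using discrete_model_measurable[OF discrete_cond_model[OF M C] \<theta>, of k "k ` C"]
      by (simp add: R)
    have v: "k -` (k ` C) \<inter> sample_space M = C"
      using k C by (auto simp: inj_on_def)
    have vB: "k -` B \<inter> sample_space M = k -` B \<inter> C"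
      using v B by blast
    have spC: "space (restrict_space (uniform_measure ?P C) C) = C"
      using C by (auto simp: space_restrict_space discrete_modelD[OF M \<theta>])
    have "emeasure ?l B = emeasure (uniform_measure ?Q (k ` C)) B"
      unfolding Q using kC B by (intro emeasure_restrict_space) auto
    also have "\<dots> = emeasure ?Q (k ` C \<inter> B) / emeasure ?Q (k ` C)"
      using kC B by (intro emeasure_uniform_measure) auto
    also have "k ` C \<inter> B = B"
      using B by auto
    also have "emeasure ?Q B = emeasure ?P (k -` B \<inter> C)"
      using kC B by (subst emeasure_distr[OF meas]) (auto simp: discrete_modelD[OF M \<theta>] vB)
    also have "emeasure ?Q (k ` C) = emeasure ?P C"
      using kC by (subst emeasure_distr[OF meas]) (auto simp: discrete_modelD[OF M \<theta>] v)
    also have "emeasure ?P (k -` B \<inter> C) / emeasure ?P C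
        = emeasure (uniform_measure ?P C) (k -` B \<inter> C)"
      using C by (subst emeasure_uniform_measure)
        (auto simp: discrete_modelD[OF M \<theta>] Int_absorb1)
    also have "\<dots> = emeasure (restrict_space (uniform_measure ?P C) C) (k -` B \<inter> C)"
      using C by (intro emeasure_restrict_space[symmetric]) (auto simp: discrete_modelD[OF M \<theta>])
    also have "\<dots> = emeasure ?r B"
      unfolding R using B by (subst emeasure_distr[OF measC]) (auto simp: spC)
    finally show "emeasure ?l B = emeasure ?r B" .
  qed
  then show ?thesis
    by (auto simp: cond_model_def[of _ "k ` C"] image_model_def[of _ _ "cond_model \<Theta> C M"]
        intro!: restrict_ext)
qed

lemma relabel_base_comp:
  assumes "discrete_model \<Theta> (fst B)"
  shows "relabel_base \<Theta> g (relabel_base \<Theta> f B) = relabel_base \<Theta> (g \<circ> f) B"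
  using image_model_comp[OF assms] by (simp add: relabel_base_def split_beta)

lemma relabel_base_ident:
  assumes "discrete_model \<Theta> (fst B)" "snd B \<in> sample_space (fst B)"
    "\<And>z. z \<in> sample_space (fst B) \<Longrightarrow> f z = z"
  shows "relabel_base \<Theta> f B = B"
  using assms image_model_ident[OF assms(1,3)] by (simp add: relabel_base_def split_beta)

lemma cond_base_simps:
  assumes "x \<in> sample_space M"
  shows "discrete_model \<Theta> (fst (cond_base \<Theta> T g (M, x)))"
    and "snd (cond_base \<Theta> T g (M, x)) \<in> sample_space (fst (cond_base \<Theta> T g (M, x)))"
    and "sample_space (fst (cond_base \<Theta> T g (M, x))) \<subseteq> T ` sample_space M"
  using assms by (auto simp: cond_base_def intro!: discrete_cond_model discrete_image_model)

section \<open>Ancillaries under relabelling\<close>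

lemma ancillary_image_model:
  assumes M: "discrete_model \<Theta> M"
  shows "ancillary \<Theta> (image_model \<Theta> k M) A \<longleftrightarrow> ancillary \<Theta> M (A \<circ> k)"
proof -
  have "distr (distribution (image_model \<Theta> k M) \<theta>)
          (count_space (A ` sample_space (image_model \<Theta> k M))) A
      = distr (distribution M \<theta>) (count_space ((A \<circ> k) ` sample_space M)) (A \<circ> k)"
    if "\<theta> \<in> \<Theta>" for \<theta>
    using image_model_comp[OF M, of A k] that
    by (auto simp: image_model_def fun_eq_iff restrict_def split: if_splits)
  then show ?thesis
    by (simp add: ancillary_def)
qed

lemma ancillary_cong:
  assumes M: "discrete_model \<Theta> M" and eq: "\<And>z. z \<in> sample_space M \<Longrightarrow> A z = B z"
  shows "ancillary \<Theta> M A \<longleftrightarrow> ancillary \<Theta> M B"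
proof -
  have "A ` sample_space M = B ` sample_space M"
    using eq by (auto simp: image_iff)
  then have "distr (distribution M \<theta>) (count_space (A ` sample_space M)) A
      = distr (distribution M \<theta>) (count_space (B ` sample_space M)) B" if "\<theta> \<in> \<Theta>" for \<theta>
    using eq that by (intro distr_cong) (auto simp: discrete_modelD[OF M])
  then show ?thesis
    by (simp add: ancillary_def)
qed

lemma ancillary_comp:
  assumes M: "discrete_model \<Theta> M" and A: "ancillary \<Theta> M A"
  shows "ancillary \<Theta> M (h \<circ> A)"
proof -
  have "distr (distribution M \<theta>) (count_space ((h \<circ> A) ` sample_space M)) (h \<circ> A)
      = distr (distr (distribution M \<theta>) (count_space (A ` sample_space M)) A)
          (count_space (h ` A ` sample_space M)) h" if "\<theta> \<in> \<Theta>" for \<theta>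
    using that
    by (subst distr_distr) (auto simp: image_comp intro!: discrete_model_measurable[OF M])
  then show ?thesis
    using A unfolding ancillary_def by metis
qed

text \<open>
  The definitions of maximal, minimal and laminal ancillaries quantify over competing statistics
  \<open>A'\<close>. When \<open>k\<close> is injective, competitors on the original model and on the relabelled one
  correspond: one direction is composition with \<open>k\<close>, the other composition with its inverse. This is
  what makes each notion invariant.
\<close>

lemma ancillary_transport:
  assumes M: "discrete_model \<Theta> M" and k: "inj_on k (sample_space M)"
  shows "ancillary \<Theta> (image_model \<Theta> k M) (A \<circ> inv_into (sample_space M) k) \<longleftrightarrow> ancillary \<Theta> M A"
  unfolding ancillary_image_model[OF M] by (rule ancillary_cong[OF M]) (simp add: k)

lemma maximal_ancillary_image_model:
  assumes M: "discrete_model \<Theta> M" and k: "inj_on k (sample_space M)"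
  shows "maximal_ancillary \<Theta> (image_model \<Theta> k M) A \<longleftrightarrow> maximal_ancillary \<Theta> M (A \<circ> k)"
proof
  assume max: "maximal_ancillary \<Theta> (image_model \<Theta> k M) A"
  show "maximal_ancillary \<Theta> M (A \<circ> k)"
    unfolding maximal_ancillary_def
  proof (intro conjI allI impI)
    show "ancillary \<Theta> M (A \<circ> k)"
      using max by (simp add: maximal_ancillary_def ancillary_image_model[OF M])
    fix A' :: "_ \<Rightarrow> nat" and h
    assume "ancillary \<Theta> M A'" and h: "\<forall>z\<in>sample_space M. (A \<circ> k) z = h (A' z)"
    then have "ancillary \<Theta> (image_model \<Theta> k M) (A' \<circ> inv_into (sample_space M) k)"
      by (simp add: ancillary_transport[OF M k])
    moreover have "\<forall>z\<in>sample_space (image_model \<Theta> k M).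
        A z = h ((A' \<circ> inv_into (sample_space M) k) z)"
      using h by (simp add: k)
    ultimately have "inj_on h ((A' \<circ> inv_into (sample_space M) k) ` k ` sample_space M)"
      using max unfolding maximal_ancillary_def sample_space_image_model by blast
    moreover have "(A' \<circ> inv_into (sample_space M) k) ` k ` sample_space M = A' ` sample_space M"
      by (auto simp: image_image k)
    ultimately show "inj_on h (A' ` sample_space M)"
      by simp
  qed
next
  assume max: "maximal_ancillary \<Theta> M (A \<circ> k)"
  show "maximal_ancillary \<Theta> (image_model \<Theta> k M) A"
    unfolding maximal_ancillary_def
  proof (intro conjI allI impI)
    show "ancillary \<Theta> (image_model \<Theta> k M) A"
      using max by (simp add: maximal_ancillary_def ancillary_image_model[OF M])
    fix A' :: "_ \<Rightarrow> nat" and h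
    assume "ancillary \<Theta> (image_model \<Theta> k M) A'"
      and "\<forall>z\<in>sample_space (image_model \<Theta> k M). A z = h (A' z)"
    then have "ancillary \<Theta> M (A' \<circ> k)" "\<forall>z\<in>sample_space M. (A \<circ> k) z = h ((A' \<circ> k) z)"
      by (simp_all add: ancillary_image_model[OF M])
    then have "inj_on h ((A' \<circ> k) ` sample_space M)"
      using max unfolding maximal_ancillary_def by blast
    then show "inj_on h (A' ` sample_space (image_model \<Theta> k M))"
      by (simp add: image_comp)
  qed
qed

lemma maximal_ancillary_cong:
  assumes M: "discrete_model \<Theta> M" and eq: "\<And>z. z \<in> sample_space M \<Longrightarrow> A z = B z"
  shows "maximal_ancillary \<Theta> M A \<longleftrightarrow> maximal_ancillary \<Theta> M B"
  using ancillary_cong[OF M eq] eq by (simp add: maximal_ancillary_def)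

lemma maximal_ancillary_transport:
  assumes M: "discrete_model \<Theta> M" and k: "inj_on k (sample_space M)"
  shows "maximal_ancillary \<Theta> (image_model \<Theta> k M) (A \<circ> inv_into (sample_space M) k)
     \<longleftrightarrow> maximal_ancillary \<Theta> M A"
  unfolding maximal_ancillary_image_model[OF M k]
  by (rule maximal_ancillary_cong[OF M]) (simp add: k)

lemma minimal_ancillary_image_model:
  assumes M: "discrete_model \<Theta> M" and k: "inj_on k (sample_space M)"
  shows "minimal_ancillary \<Theta> (image_model \<Theta> k M) A \<longleftrightarrow> minimal_ancillary \<Theta> M (A \<circ> k)"
proof
  assume min: "minimal_ancillary \<Theta> (image_model \<Theta> k M) A"
  show "minimal_ancillary \<Theta> M (A \<circ> k)"
    unfolding minimal_ancillary_def
  proof (intro conjI allI impI)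
    show "ancillary \<Theta> M (A \<circ> k)"
      using min by (simp add: minimal_ancillary_def ancillary_image_model[OF M])
    fix A' :: "_ \<Rightarrow> nat" assume "maximal_ancillary \<Theta> M A'"
    then have "maximal_ancillary \<Theta> (image_model \<Theta> k M) (A' \<circ> inv_into (sample_space M) k)"
      by (simp add: maximal_ancillary_transport[OF M k])
    then obtain h where
      "\<forall>z\<in>k ` sample_space M. A z = h ((A' \<circ> inv_into (sample_space M) k) z)"
      using min unfolding minimal_ancillary_def sample_space_image_model by blast
    then show "\<exists>h. \<forall>z\<in>sample_space M. (A \<circ> k) z = h (A' z)"
      by (auto simp: k)
  qed
next
  assume min: "minimal_ancillary \<Theta> M (A \<circ> k)"
  show "minimal_ancillary \<Theta> (image_model \<Theta> k M) A"
    unfolding minimal_ancillary_def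
  proof (intro conjI allI impI)
    show "ancillary \<Theta> (image_model \<Theta> k M) A"
      using min by (simp add: minimal_ancillary_def ancillary_image_model[OF M])
    fix A' :: "_ \<Rightarrow> nat" assume "maximal_ancillary \<Theta> (image_model \<Theta> k M) A'"
    then have "maximal_ancillary \<Theta> M (A' \<circ> k)"
      by (simp add: maximal_ancillary_image_model[OF M k])
    then obtain h where "\<forall>z\<in>sample_space M. (A \<circ> k) z = h ((A' \<circ> k) z)"
      using min unfolding minimal_ancillary_def by blast
    then show "\<exists>h. \<forall>z\<in>sample_space (image_model \<Theta> k M). A z = h (A' z)"
      by auto
  qed
qed

lemma laminal_ancillary_pullback:
  assumes M: "discrete_model \<Theta> M" and k: "inj_on k (sample_space M)"
    and lam: "laminal_ancillary \<Theta> (image_model \<Theta> k M) A"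
  shows "laminal_ancillary \<Theta> M (A \<circ> k)"
  unfolding laminal_ancillary_def
proof (intro conjI allI impI)
  show "minimal_ancillary \<Theta> M (A \<circ> k)"
    using lam by (simp add: laminal_ancillary_def minimal_ancillary_image_model[OF M k])
  fix A' :: "_ \<Rightarrow> nat" assume min: "minimal_ancillary \<Theta> M A'"
  have "minimal_ancillary \<Theta> M (A' \<circ> inv_into (sample_space M) k \<circ> k) \<longleftrightarrow> minimal_ancillary \<Theta> M A'"
    using ancillary_cong[OF M, of "A' \<circ> inv_into (sample_space M) k \<circ> k" A']
    by (simp add: minimal_ancillary_def k)
  with min have
    "minimal_ancillary \<Theta> (image_model \<Theta> k M) (A' \<circ> inv_into (sample_space M) k)"
    by (simp add: minimal_ancillary_image_model[OF M k])
  then obtain h where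
    "\<forall>z\<in>k ` sample_space M. (A' \<circ> inv_into (sample_space M) k) z = h (A z)"
    using lam unfolding laminal_ancillary_def sample_space_image_model by blast
  then show "\<exists>h. \<forall>z\<in>sample_space M. A' z = h ((A \<circ> k) z)"
    by (auto simp: k)
qed

section \<open>Existence and uniqueness up to relabelling\<close>

lemma ex_nat_labelling:
  assumes "finite S" "equiv S r"
  obtains f :: "'x \<Rightarrow> nat" where "\<And>y z. y \<in> S \<Longrightarrow> z \<in> S \<Longrightarrow> f y = f z \<longleftrightarrow> (y, z) \<in> r"
proof -
  have "finite (S // r)"
    using assms by (intro finite_quotient) (auto elim: equivE)
  then obtain i :: "'x set \<Rightarrow> nat" where i: "inj_on i (S // r)"
    by (meson finite_imp_inj_to_nat_seg)
  show ?thesis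
  proof (rule that[of "\<lambda>y. i (r `` {y})"])
    fix y z assume "y \<in> S" "z \<in> S"
    then show "i (r `` {y}) = i (r `` {z}) \<longleftrightarrow> (y, z) \<in> r"
      using inj_on_eq_iff[OF i] eq_equiv_class_iff[OF assms(2)] by (simp add: quotientI)
  qed
qed

text \<open>
  The constant can be inverted: it is nonzero because \<open>y\<close> has positive probability for some \<open>\<theta>\<close>.
\<close>

lemma suff_equiv_sym:
  assumes M: "stat_model \<Theta> M" and y: "y \<in> sample_space M" and "suff_equiv \<Theta> M y z"
  shows "suff_equiv \<Theta> M z y"
proof -
  obtain c where c: "\<And>\<theta>. \<theta> \<in> \<Theta> \<Longrightarrow>
      measure (distribution M \<theta>) {y} = c * measure (distribution M \<theta>) {z}"
    using assms(3) by (auto simp: suff_equiv_def)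
  obtain \<theta> where "\<theta> \<in> \<Theta>" "measure (distribution M \<theta>) {y} > 0"
    using M y by (auto simp: stat_model_def)
  with c[of \<theta>] have "c \<noteq> 0"
    by auto
  with c show ?thesis
    unfolding suff_equiv_def by (intro exI[of _ "inverse c"]) auto
qed

lemma ex_min_sufficient:
  assumes M: "stat_model \<Theta> M"
  obtains T :: "'x \<Rightarrow> nat" where "min_sufficient \<Theta> (M :: ('p, 'x) model) T"
proof -
  let ?S = "sample_space M"
  let ?r = "{(y, z). y \<in> ?S \<and> z \<in> ?S \<and> suff_equiv \<Theta> M y z}"
  have "equiv ?S ?r"
  proof (rule equivI)
    show "refl_on ?S ?r"
      by (auto simp: refl_on_def suff_equiv_def intro!: exI[of _ 1])
    show "sym ?r"
      by (auto simp: sym_def intro: suff_equiv_sym[OF M])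
    have "suff_equiv \<Theta> M x z" if "suff_equiv \<Theta> M x y" "suff_equiv \<Theta> M y z" for x y z
    proof -
      from that obtain c d where
        "\<forall>\<theta>\<in>\<Theta>. measure (distribution M \<theta>) {x} = c * measure (distribution M \<theta>) {y}"
        "\<forall>\<theta>\<in>\<Theta>. measure (distribution M \<theta>) {y} = d * measure (distribution M \<theta>) {z}"
        unfolding suff_equiv_def by blast
      then show ?thesis
        unfolding suff_equiv_def by (intro exI[of _ "c * d"]) auto
    qed
    then show "trans ?r"
      unfolding trans_def by blast
  qed auto
  moreover have "finite ?S"
    using M by (simp add: stat_model_def)
  ultimately obtain T :: "'x \<Rightarrow> nat" where
    "\<And>y z. y \<in> ?S \<Longrightarrow> z \<in> ?S \<Longrightarrow> T y = T z \<longleftrightarrow> (y, z) \<in> ?r"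
    using ex_nat_labelling by blast
  then have "min_sufficient \<Theta> M T"
    by (simp add: min_sufficient_def)
  then show ?thesis
    by (rule that)
qed

text \<open>
  This turns ``is a function of'' into inclusion between the partitions into level sets, where
  statistics no longer need labels.
\<close>

lemma factors_through_iff:
  "(\<exists>h. \<forall>z\<in>S. A z = h (B z)) \<longleftrightarrow> (\<forall>y\<in>S. \<forall>z\<in>S. B y = B z \<longrightarrow> A y = A z)"
  using function_factors_left_gen[of "\<lambda>z. z \<in> S" B A] by blast

text \<open>
  An ancillary with the largest possible number of values is maximal: if it is \<open>h \<circ> A'\<close> with \<open>A'\<close>
  ancillary, then \<open>A'\<close> has no more values than it, and so \<open>h\<close> merges none of them. Constants are
  ancillary, so there is something to maximise over.
\<close>

lemma ex_maximal_ancillary: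
  assumes M: "discrete_model \<Theta> M" and fin: "finite (sample_space M)"
    and prob: "\<And>\<theta>. \<theta> \<in> \<Theta> \<Longrightarrow> prob_space (distribution M \<theta>)"
  obtains A :: "'x \<Rightarrow> nat" where "maximal_ancillary \<Theta> (M :: ('p, 'x) model) A"
proof -
  let ?S = "sample_space M"
  let ?n = "\<lambda>A :: 'x \<Rightarrow> nat. card (A ` ?S)"
  have const: "ancillary \<Theta> M (\<lambda>_. 0 :: nat)"
  proof (cases "?S = {}")
    \<comment> \<open>A probability space is nonempty, so here \<open>\<Theta>\<close> is empty.\<close>
    case True
    then have False if "\<theta> \<in> \<Theta>" for \<theta>
      using prob[OF that] prob_space.not_empty discrete_modelD(2)[OF M that] by metis
    then show ?thesis
      by (auto simp: ancillary_def)
  next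
    case False
    have "distr (distribution M \<theta>) (count_space ((\<lambda>_. 0 :: nat) ` ?S)) (\<lambda>_. 0)
        = return (count_space ((\<lambda>_. 0) ` ?S)) 0" if "\<theta> \<in> \<Theta>" for \<theta>
      using False by (intro prob_space.distr_const[OF prob[OF that]]) auto
    then show ?thesis
      by (simp add: ancillary_def)
  qed
  have bound: "\<forall>A. ancillary \<Theta> M A \<longrightarrow> ?n A < Suc (card ?S)"
    by (simp add: le_imp_less_Suc card_image_le[OF fin])
  obtain A :: "'x \<Rightarrow> nat" where A: "ancillary \<Theta> M A"
    and most: "\<And>A'. ancillary \<Theta> M A' \<Longrightarrow> ?n A' \<le> ?n A"
    using ex_has_greatest_nat[OF const bound] by blast
  have "inj_on h (A' ` ?S)"
    if A': "ancillary \<Theta> M A'" and h: "\<forall>z\<in>?S. A z = h (A' z)" for A' :: "'x \<Rightarrow> nat" and h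
  proof (rule eq_card_imp_inj_on)
    show "finite (A' ` ?S)"
      using fin by simp
    have "h ` A' ` ?S = A ` ?S"
      using h by (auto simp: image_iff)
    then show "card (h ` A' ` ?S) = card (A' ` ?S)"
      using most[OF A'] card_image_le[of "A' ` ?S" h] fin by simp
  qed
  with A have "maximal_ancillary \<Theta> M A"
    by (simp add: maximal_ancillary_def)
  then show ?thesis
    by (rule that)
qed

text \<open>
  The laminal ancillary is the join of all minimal ancillaries. Its level sets are the intersections
  of theirs, and if \<open>A\<close> is a maximal ancillary, no minimal ancillary separates two points with the
  same value of \<open>A\<close>; hence the join does not separate them either and is a function of \<open>A\<close>.
\<close>

lemma ex_laminal_ancillary:
  assumes M: "discrete_model \<Theta> M" and fin: "finite (sample_space M)"
    and prob: "\<And>\<theta>. \<theta> \<in> \<Theta> \<Longrightarrow> prob_space (distribution M \<theta>)"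
  obtains L :: "'x \<Rightarrow> nat" where "laminal_ancillary \<Theta> (M :: ('p, 'x) model) L"
proof -
  let ?S = "sample_space M"
  let ?r = "{(y, z). y \<in> ?S \<and> z \<in> ?S \<and>
    (\<forall>B :: 'x \<Rightarrow> nat. minimal_ancillary \<Theta> M B \<longrightarrow> B y = B z)}"
  have "equiv ?S ?r"
    by (rule equivI) (auto simp: refl_on_def sym_def trans_def)
  from ex_nat_labelling[OF fin this] obtain L :: "'x \<Rightarrow> nat" where
    L: "\<And>y z. y \<in> ?S \<Longrightarrow> z \<in> ?S \<Longrightarrow>
      L y = L z \<longleftrightarrow> (\<forall>B :: 'x \<Rightarrow> nat. minimal_ancillary \<Theta> M B \<longrightarrow> B y = B z)"
    by auto
  have fct: "\<exists>h. \<forall>z\<in>?S. L z = h (A z)" if "maximal_ancillary \<Theta> M A" for A :: "'x \<Rightarrow> nat"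
    unfolding factors_through_iff
  proof (intro ballI impI)
    fix y z assume yz: "y \<in> ?S" "z \<in> ?S" "A y = A z"
    have "B y = B z" if "minimal_ancillary \<Theta> M B" for B :: "'x \<Rightarrow> nat"
      using that \<open>maximal_ancillary \<Theta> M A\<close> yz unfolding minimal_ancillary_def by metis
    then show "L y = L z"
      using L yz by blast
  qed
  obtain A :: "'x \<Rightarrow> nat" where A: "maximal_ancillary \<Theta> M A"
    using ex_maximal_ancillary[OF assms] .
  from fct[OF A] obtain h where "\<forall>z\<in>?S. L z = h (A z)" ..
  then have "ancillary \<Theta> M L \<longleftrightarrow> ancillary \<Theta> M (h \<circ> A)"
    by (intro ancillary_cong[OF M]) simp
  moreover have "ancillary \<Theta> M (h \<circ> A)"
    using A by (intro ancillary_comp[OF M]) (simp add: maximal_ancillary_def)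
  ultimately have "minimal_ancillary \<Theta> M L"
    using fct by (simp add: minimal_ancillary_def)
  moreover have "\<exists>h. \<forall>z\<in>?S. B z = h (L z)" if "minimal_ancillary \<Theta> M B" for B :: "'x \<Rightarrow> nat"
    unfolding factors_through_iff using L that by blast
  ultimately have "laminal_ancillary \<Theta> M L"
    by (simp add: laminal_ancillary_def)
  then show ?thesis
    by (rule that)
qed

lemma laminal_ancillary_unique:
  fixes A B :: "'x \<Rightarrow> nat"
  assumes "laminal_ancillary \<Theta> M A" "laminal_ancillary \<Theta> M B"
    and "y \<in> sample_space M" "z \<in> sample_space M"
  shows "A y = A z \<longleftrightarrow> B y = B z"
proof -
  obtain h h' where "\<forall>z\<in>sample_space M. A z = h (B z)" "\<forall>z\<in>sample_space M. B z = h' (A z)"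
    using assms(1,2) unfolding laminal_ancillary_def by metis
  then show ?thesis
    using assms(3,4) by metis
qed

lemma min_sufficient_unique:
  assumes "min_sufficient \<Theta> M T" "min_sufficient \<Theta> M T'"
  obtains k where "bij_betw k (T' ` sample_space M) (T ` sample_space M)"
    and "\<And>z. z \<in> sample_space M \<Longrightarrow> T z = k (T' z)"
proof -
  let ?S = "sample_space M"
  have eq: "T y = T z \<longleftrightarrow> T' y = T' z" if "y \<in> ?S" "z \<in> ?S" for y z
    using assms that by (simp add: min_sufficient_def)
  then have "\<exists>k. \<forall>z\<in>?S. T z = k (T' z)"
    unfolding factors_through_iff by blast
  then obtain k where k: "\<And>z. z \<in> ?S \<Longrightarrow> T z = k (T' z)"
    by blast
  have "bij_betw k (T' ` ?S) (T ` ?S)"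
    using k eq by (auto simp: bij_betw_def inj_on_def image_iff)
  then show ?thesis
    using k by (rule that)
qed

text \<open>
  The conditional base does not depend on the chosen minimal sufficient statistic and laminal
  ancillary beyond a relabelling, and the relabelling extends to a bijection of the full ranges, as
  composition in \<^const>\<open>stable_cond\<close> demands.
\<close>

lemma cond_base_unique:
  fixes T T' :: "'x \<Rightarrow> nat" and g g' :: "nat \<Rightarrow> nat"
  assumes M: "discrete_model \<Theta> M" and x: "x \<in> sample_space M"
    and T: "min_sufficient \<Theta> M T" "laminal_ancillary \<Theta> (image_model \<Theta> T M) g"
    and T': "min_sufficient \<Theta> M T'" "laminal_ancillary \<Theta> (image_model \<Theta> T' M) g'"
  obtains k where "bij_betw k (T' ` sample_space M) (T ` sample_space M)"
    and "cond_base \<Theta> T g (M, x) = relabel_base \<Theta> k (cond_base \<Theta> T' g' (M, x))"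
proof -
  let ?S = "sample_space M"
  obtain k where bij: "bij_betw k (T' ` ?S) (T ` ?S)" and k: "\<And>z. z \<in> ?S \<Longrightarrow> T z = k (T' z)"
    using min_sufficient_unique[OF T(1) T'(1)] by blast
  define N where "N = image_model \<Theta> T' M"
  have N: "discrete_model \<Theta> N" and [simp]: "sample_space N = T' ` ?S"
    by (simp_all add: N_def discrete_image_model)
  have inj: "inj_on k (sample_space N)"
    using bij by (simp add: bij_betw_def)
  have TN: "image_model \<Theta> T M = image_model \<Theta> k N"
    unfolding N_def image_model_comp[OF M] using k by (intro image_model_cong[OF M]) simp
  \<comment> \<open>Both \<open>g\<close> and \<open>g'\<close> are compared on the model \<open>N\<close> of \<open>T'\<close>, where laminal ancillaries have
      the same level sets.\<close>
  have "laminal_ancillary \<Theta> N (g \<circ> k)"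
    using T(2) by (intro laminal_ancillary_pullback[OF N inj]) (simp add: TN)
  with T'(2) have ker: "g (k t) = g (k u) \<longleftrightarrow> g' t = g' u" if "t \<in> T' ` ?S" "u \<in> T' ` ?S" for t u
    using laminal_ancillary_unique[of \<Theta> N "g \<circ> k" g' t u] that by (simp add: N_def)
  let ?C = "{t \<in> T' ` ?S. g' t = g' (T' x)}"
  have "{t \<in> T ` ?S. g t = g (T x)} = k ` ?C"
    using ker k x by (auto simp: image_iff)
  moreover have "cond_model \<Theta> (k ` ?C) (image_model \<Theta> k N) = image_model \<Theta> k (cond_model \<Theta> ?C N)"
    by (rule cond_model_image_model[OF N inj]) auto
  ultimately have "cond_base \<Theta> T g (M, x) = relabel_base \<Theta> k (cond_base \<Theta> T' g' (M, x))"
    using k[OF x] by (simp add: cond_base_def relabel_base_def TN flip: N_def)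
  with bij show ?thesis
    by (rule that)
qed

section \<open>Stable conditionality\<close>

lemma stable_cond_refl:
  assumes "inference_base \<Theta> (B :: ('p, 'x) base)"
  shows "(B, B) \<in> stable_cond \<Theta>"
proof -
  obtain M x where B: "B = (M, x)" and M: "stat_model \<Theta> M" and x: "x \<in> sample_space M"
    using assms by (auto simp: inference_base_def)
  note d = stat_model_discrete[OF M]
  obtain T :: "'x \<Rightarrow> nat" where T: "min_sufficient \<Theta> M T"
    using ex_min_sufficient[OF M] .
  have "prob_space (distribution (image_model \<Theta> T M) \<theta>)" if "\<theta> \<in> \<Theta>" for \<theta>
  proof -
    have "prob_space (distribution M \<theta>)"
      using M that by (auto simp: stat_model_def PiE_iff)
    from prob_space.prob_space_distr[OF this
        discrete_model_measurable[OF d that order_refl]] show ?thesis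
      using that by (simp add: image_model_def)
  qed
  moreover have "finite (sample_space (image_model \<Theta> T M))"
    using M by (simp add: stat_model_def)
  ultimately obtain g :: "nat \<Rightarrow> nat" where g: "laminal_ancillary \<Theta> (image_model \<Theta> T M) g"
    using ex_laminal_ancillary[OF discrete_image_model] by blast
  have "cond_base \<Theta> T g B = relabel_base \<Theta> id (cond_base \<Theta> T g B)"
    unfolding B using cond_base_simps[OF x] by (intro relabel_base_ident[symmetric]) auto
  then show ?thesis
    unfolding stable_cond_def using assms T g B bij_betw_id by fastforce
qed

lemma stable_cond_sym:
  assumes "(B\<^sub>1, B\<^sub>2) \<in> stable_cond \<Theta>"
  shows "(B\<^sub>2, B\<^sub>1) \<in> stable_cond \<Theta>"
proof -
  from assms obtain T\<^sub>1 T\<^sub>2 :: "'b \<Rightarrow> nat" and g\<^sub>1 g\<^sub>2 :: "nat \<Rightarrow> nat" and h where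
    IB: "inference_base \<Theta> B\<^sub>1" "inference_base \<Theta> B\<^sub>2"
    and T: "min_sufficient \<Theta> (fst B\<^sub>1) T\<^sub>1" "laminal_ancillary \<Theta> (image_model \<Theta> T\<^sub>1 (fst B\<^sub>1)) g\<^sub>1"
      "min_sufficient \<Theta> (fst B\<^sub>2) T\<^sub>2" "laminal_ancillary \<Theta> (image_model \<Theta> T\<^sub>2 (fst B\<^sub>2)) g\<^sub>2"
    and h: "bij_betw h (T\<^sub>2 ` sample_space (fst B\<^sub>2)) (T\<^sub>1 ` sample_space (fst B\<^sub>1))"
    and eq: "cond_base \<Theta> T\<^sub>1 g\<^sub>1 B\<^sub>1 = relabel_base \<Theta> h (cond_base \<Theta> T\<^sub>2 g\<^sub>2 B\<^sub>2)"
    unfolding stable_cond_def by blast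
  obtain M x where B: "B\<^sub>2 = (M, x)" and x: "x \<in> sample_space M"
    using IB(2) by (auto simp: inference_base_def)
  let ?h = "inv_into (T\<^sub>2 ` sample_space M) h"
  have "relabel_base \<Theta> ?h (cond_base \<Theta> T\<^sub>1 g\<^sub>1 B\<^sub>1)
      = relabel_base \<Theta> (?h \<circ> h) (cond_base \<Theta> T\<^sub>2 g\<^sub>2 B\<^sub>2)"
    unfolding eq B by (rule relabel_base_comp[OF cond_base_simps(1)[OF x]])
  also have "\<dots> = cond_base \<Theta> T\<^sub>2 g\<^sub>2 B\<^sub>2"
    unfolding B
  proof (rule relabel_base_ident[OF cond_base_simps(1,2)[OF x]])
    fix t assume "t \<in> sample_space (fst (cond_base \<Theta> T\<^sub>2 g\<^sub>2 (M, x)))"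
    then have "t \<in> T\<^sub>2 ` sample_space M"
      using cond_base_simps(3)[OF x, of \<Theta> T\<^sub>2 g\<^sub>2] by blast
    then show "(?h \<circ> h) t = t"
      using h by (simp add: B bij_betw_def)
  qed
  finally have "cond_base \<Theta> T\<^sub>2 g\<^sub>2 B\<^sub>2 = relabel_base \<Theta> ?h (cond_base \<Theta> T\<^sub>1 g\<^sub>1 B\<^sub>1)" ..
  moreover have "bij_betw ?h (T\<^sub>1 ` sample_space (fst B\<^sub>1)) (T\<^sub>2 ` sample_space (fst B\<^sub>2))"
    using bij_betw_inv_into[OF h] by (simp add: B)
  ultimately show ?thesis
    unfolding stable_cond_def using IB T by blast
qed

lemma stable_cond_trans:
  assumes "(B\<^sub>1, B\<^sub>2) \<in> stable_cond \<Theta>" "(B\<^sub>2, B\<^sub>3) \<in> stable_cond \<Theta>"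
  shows "(B\<^sub>1, B\<^sub>3) \<in> stable_cond \<Theta>"
proof -
  from assms(1) obtain T\<^sub>1 T\<^sub>2 :: "'b \<Rightarrow> nat" and g\<^sub>1 g\<^sub>2 :: "nat \<Rightarrow> nat" and h where
    IB: "inference_base \<Theta> B\<^sub>1" "inference_base \<Theta> B\<^sub>2"
    and T: "min_sufficient \<Theta> (fst B\<^sub>1) T\<^sub>1" "laminal_ancillary \<Theta> (image_model \<Theta> T\<^sub>1 (fst B\<^sub>1)) g\<^sub>1"
      "min_sufficient \<Theta> (fst B\<^sub>2) T\<^sub>2" "laminal_ancillary \<Theta> (image_model \<Theta> T\<^sub>2 (fst B\<^sub>2)) g\<^sub>2"
    and h: "bij_betw h (T\<^sub>2 ` sample_space (fst B\<^sub>2)) (T\<^sub>1 ` sample_space (fst B\<^sub>1))"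
    and eq: "cond_base \<Theta> T\<^sub>1 g\<^sub>1 B\<^sub>1 = relabel_base \<Theta> h (cond_base \<Theta> T\<^sub>2 g\<^sub>2 B\<^sub>2)"
    unfolding stable_cond_def by blast
  from assms(2) obtain T\<^sub>2' T\<^sub>3 :: "'b \<Rightarrow> nat" and g\<^sub>2' g\<^sub>3 :: "nat \<Rightarrow> nat" and h' where
    IB': "inference_base \<Theta> B\<^sub>3"
    and T': "min_sufficient \<Theta> (fst B\<^sub>2) T\<^sub>2'" "laminal_ancillary \<Theta> (image_model \<Theta> T\<^sub>2' (fst B\<^sub>2)) g\<^sub>2'"
      "min_sufficient \<Theta> (fst B\<^sub>3) T\<^sub>3" "laminal_ancillary \<Theta> (image_model \<Theta> T\<^sub>3 (fst B\<^sub>3)) g\<^sub>3"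
    and h': "bij_betw h' (T\<^sub>3 ` sample_space (fst B\<^sub>3)) (T\<^sub>2' ` sample_space (fst B\<^sub>2))"
    and eq': "cond_base \<Theta> T\<^sub>2' g\<^sub>2' B\<^sub>2 = relabel_base \<Theta> h' (cond_base \<Theta> T\<^sub>3 g\<^sub>3 B\<^sub>3)"
    unfolding stable_cond_def by blast
  obtain M\<^sub>2 x\<^sub>2 where B2: "B\<^sub>2 = (M\<^sub>2, x\<^sub>2)" and M2: "discrete_model \<Theta> M\<^sub>2"
    and x2: "x\<^sub>2 \<in> sample_space M\<^sub>2"
    using IB(2) by (auto simp: inference_base_def stat_model_discrete)
  obtain M\<^sub>3 x\<^sub>3 where B3: "B\<^sub>3 = (M\<^sub>3, x\<^sub>3)" and x3: "x\<^sub>3 \<in> sample_space M\<^sub>3"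
    using IB' by (auto simp: inference_base_def)
  obtain k where k: "bij_betw k (T\<^sub>2' ` sample_space (fst B\<^sub>2)) (T\<^sub>2 ` sample_space (fst B\<^sub>2))"
    and eqk: "cond_base \<Theta> T\<^sub>2 g\<^sub>2 B\<^sub>2 = relabel_base \<Theta> k (cond_base \<Theta> T\<^sub>2' g\<^sub>2' B\<^sub>2)"
    using cond_base_unique[OF M2 x2, of T\<^sub>2 g\<^sub>2 T\<^sub>2' g\<^sub>2'] T(3,4) T'(1,2) unfolding B2 fst_conv by blast
  have d2: "discrete_model \<Theta> (fst (cond_base \<Theta> T\<^sub>2' g\<^sub>2' B\<^sub>2))"
    unfolding B2 by (rule cond_base_simps(1)[OF x2])
  have d3: "discrete_model \<Theta> (fst (cond_base \<Theta> T\<^sub>3 g\<^sub>3 B\<^sub>3))"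
    unfolding B3 by (rule cond_base_simps(1)[OF x3])
  have "cond_base \<Theta> T\<^sub>1 g\<^sub>1 B\<^sub>1 = relabel_base \<Theta> (h \<circ> k) (cond_base \<Theta> T\<^sub>2' g\<^sub>2' B\<^sub>2)"
    unfolding eq eqk by (rule relabel_base_comp[OF d2])
  also have "\<dots> = relabel_base \<Theta> (h \<circ> k \<circ> h') (cond_base \<Theta> T\<^sub>3 g\<^sub>3 B\<^sub>3)"
    unfolding eq' by (rule relabel_base_comp[OF d3])
  finally have "cond_base \<Theta> T\<^sub>1 g\<^sub>1 B\<^sub>1 = relabel_base \<Theta> (h \<circ> k \<circ> h') (cond_base \<Theta> T\<^sub>3 g\<^sub>3 B\<^sub>3)" .
  moreover have "bij_betw (h \<circ> k \<circ> h') (T\<^sub>3 ` sample_space (fst B\<^sub>3)) (T\<^sub>1 ` sample_space (fst B\<^sub>1))"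
    using bij_betw_trans[OF h' bij_betw_trans[OF k h]] .
  ultimately show ?thesis
    unfolding stable_cond_def using IB(1) IB' T(1,2) T'(3,4) by blast
qed

theorem proposition3:
  fixes \<Theta> :: "'p set"
  assumes "finite \<Theta>"
  shows "equiv {B :: ('p, 'x) base. inference_base \<Theta> B} (stable_cond \<Theta>)"
proof (rule equivI)
  show "stable_cond \<Theta> \<subseteq> {B :: ('p, 'x) base. inference_base \<Theta> B} \<times> {B. inference_base \<Theta> B}"
    by (auto simp: stable_cond_def)
  show "refl_on {B :: ('p, 'x) base. inference_base \<Theta> B} (stable_cond \<Theta>)"
    by (auto simp: refl_on_def intro: stable_cond_refl)
  show "sym (stable_cond \<Theta> :: ('p, 'x) base rel)"
    by (auto simp: sym_def intro: stable_cond_sym)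
  show "trans (stable_cond \<Theta> :: ('p, 'x) base rel)"
    by (blast intro: transI stable_cond_trans)
qed

end
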